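(* (i) (Odd.) For all $n\ge1$, $\Lambda_{2n+1}$ is the union of the three consecutive, disjoint integer intervals $\Lambda^{(a)}_{2n-1}=\Lambda_{2n-1}+L_{2n}$, $\Lambda^{(b)}_{2n-2}=\Lambda_{2n-2}+L_{2n+1}$, $\Lambda^{(c)}_{2n-1}=\Lambda_{2n-1}+L_{2n+1}$, and $$\beta(N)=1000\,(10)^{-1}\beta(N-L_{2n})(01)^{-1}1001\ \ (N\in\Lambda^{(a)}_{2n-1}),$$ $$\beta(N)=100\,\beta(N-L_{2n+1})(01)^{-1}001001\ \ (N\in\Lambda^{(b)}_{2n-2}),$$ $$\beta(N)=10\,\beta(N-L_{2n+1})(01)^{-1}0001\ \ (N\in\Lambda^{(c)}_{2n-1}).$$ (ii) (Even.) For all $n\ge1$, $\Lambda_{2n+2}$ is the union of the three consecutive, disjoint integer intervals $\Lambda^{(a)}_{2n}=\Lambda_{2n}+L_{2n+1}$, $\Lambda^{(b)}_{2n-1}=\Lambda_{2n-1}+L_{2n+2}$, $\Lambda^{(c)}_{2n}=\Lambda_{2n}+L_{2n+2}$, and $$\beta(N)=1000\,(10)^{-1}\beta(N-L_{2n+1})(01)^{-1}0001\ \ (N\in\Lambda^{(a)}_{2n}),$$ $$\beta(N)=100\,\beta(N-L_{2n+2})\,01\ \ (N\in\Lambda^{(b)}_{2n-1}),$$ $$\beta(N)=10\,\beta(N-L_{2n+1})\,01\ \ (N\in\Lambda^{(c)}_{2n}).$$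
   Context: Let $\varphi=(1+\sqrt5)/2$. Every integer $N\ge1$ has a unique base phi expansion $N=\sum_{i\in\mathbb Z} d_i\varphi^i$ with $d_i\in\{0,1\}$, finitely many nonzero, and $d_id_{i+1}=0$ for all $i$; writing $L$ (resp. $R$) for the largest (resp. smallest) index with $d_i=1$, $\beta(N)$ is the word $d_L\cdots d_1d_0\cdot d_{-1}\cdots d_R$ with a radix point "$\cdot$" between $d_0$ and $d_{-1}$ (if $R\ge0$ nothing follows the point). Lucas numbers: $L_0=2$, $L_1=1$, $L_n=L_{n-1}+L_{n-2}$. Lucas intervals (integer intervals): $\Lambda_{2n}=[L_{2n},L_{2n+1}]$, $\Lambda_{2n+1}=[L_{2n+1}+1,L_{2n+2}-1]$ for $n\ge0$ (so $\Lambda_0=\emptyset$). For a set $A$ of integers and an integer $x$, $A+x=\{a+x:a\in A\}$. Products of words are computed in the free group on $\{0,1\}$, with the radix point treated as an extra letter that is never cancelled; e.g. $(01)^{-1}0001=1^{-1}001$, and $u^{-1}$ cancels against the matching letters adjacent to it.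
   Formalization: The last formula of (ii) is proved as β(N)=10 β(N−L_{2n+2}) 01; the printed β(N−L_{2n+1}) is a misprint, false e.g. for n=1, N=10, where β(10)=10100·0101 but 10 β(6) 01=101010·000101. *)

theory Defs
  imports Complex_Main
begin

definition phi :: real where
  "phi = (1 + sqrt 5) / 2"

definition is_base_phi_expansion :: "int \<Rightarrow> (int \<Rightarrow> nat) \<Rightarrow> bool" where
  "is_base_phi_expansion N d \<longleftrightarrow>
     (\<forall>i. d i \<in> {0, 1}) \<and> finite {i. d i \<noteq> 0} \<and> (\<forall>i. d i * d (i + 1) = 0) \<and>
     real_of_int N = (\<Sum>i | d i \<noteq> 0. real (d i) * phi powi i)"

definition phi_digit :: "int \<Rightarrow> int \<Rightarrow> nat" where
  "phi_digit N = (THE d. is_base_phi_expansion N d)"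

datatype letter = D0 | D1 | Point

definition digit_letter :: "nat \<Rightarrow> letter" where
  "digit_letter k = (if k = 0 then D0 else D1)"

text \<open>
  The word \<open>d\<^sub>L \<dots> d\<^sub>0 \<cdot> d\<^sub>-\<^sub>1 \<dots> d\<^sub>R\<close>, meaningful for \<open>N \<ge> 1\<close>.
  If \<open>R \<ge> 0\<close> then \<open>[1..- R]\<close> is empty and nothing follows the point.
\<close>

definition beta :: "int \<Rightarrow> letter list" where
  "beta N =
     (let d = phi_digit N; L = Max {i. d i = 1}; R = Min {i. d i = 1} in
        map (\<lambda>i. digit_letter (d i)) (rev [0..L]) @
        Point # map (\<lambda>i. digit_letter (d (- i))) [1..- R])"

fun lucas :: "nat \<Rightarrow> int" where
  "lucas 0 = 2"
| "lucas (Suc 0) = 1"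
| "lucas (Suc (Suc n)) = lucas (Suc n) + lucas n"

definition Lucas_interval :: "nat \<Rightarrow> int set" ("\<Lambda>") where
  "\<Lambda> m = (if even m then {lucas m .. lucas (m + 1)}
          else {lucas m + 1 .. lucas (m + 1) - 1})"

definition translate :: "int set \<Rightarrow> int \<Rightarrow> int set" where
  "translate A x = {a + x | a. a \<in> A}"

text \<open>
  Half-open intervals let any of the three be empty; the remaining ones must then still
  be adjacent. This is needed because \<open>\<Lambda> 0\<close> is empty.
\<close>

definition consecutive_intervals :: "int set \<Rightarrow> int set \<Rightarrow> int set \<Rightarrow> bool" where
  "consecutive_intervals A B C \<longleftrightarrow>
     (\<exists>p q r s. p \<le> q \<and> q \<le> r \<and> r \<le> s \<and> A = {p..<q} \<and> B = {q..<r} \<and> C = {r..<s})"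

text \<open>
  Signed words \<open>('a \<times> bool) list\<close>, where \<open>(x, False)\<close> is the formal inverse of \<open>(x, True)\<close>,
  modulo insertion and deletion of adjacent mutually inverse letters.
\<close>

inductive fg_eq :: "('a \<times> bool) list \<Rightarrow> ('a \<times> bool) list \<Rightarrow> bool" where
  cancel: "fg_eq (u @ (x, b) # (x, \<not> b) # v) (u @ v)"
| refl: "fg_eq u u"
| sym: "fg_eq u v \<Longrightarrow> fg_eq v u"
| trans: "fg_eq u v \<Longrightarrow> fg_eq v w \<Longrightarrow> fg_eq u w"

quotient_type 'a free_group = "('a \<times> bool) list" / fg_eq
  by (intro equivpI reflpI sympI transpI) (blast intro: fg_eq.intros)+

lemma fg_eq_context: "fg_eq u v \<Longrightarrow> fg_eq (p @ u @ s) (p @ v @ s)"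
proof (induction rule: fg_eq.induct)
  case (cancel u x b v)
  show ?case using fg_eq.cancel[of "p @ u" x b "v @ s"] by simp
qed (blast intro: fg_eq.intros)+

lemma fg_eq_append: "fg_eq u u' \<Longrightarrow> fg_eq v v' \<Longrightarrow> fg_eq (u @ v) (u' @ v')"
  using fg_eq_context[of u u' "[]" v] fg_eq_context[of v v' u' "[]"]
  by (auto intro: fg_eq.trans)

definition fg_inv :: "('a \<times> bool) list \<Rightarrow> ('a \<times> bool) list" where
  "fg_inv u = rev (map (\<lambda>(x, b). (x, \<not> b)) u)"

lemma fg_inv_simps [simp]:
  "fg_inv [] = []" "fg_inv ((x, b) # u) = fg_inv u @ [(x, \<not> b)]"
  "fg_inv (u @ v) = fg_inv v @ fg_inv u"
  by (simp_all add: fg_inv_def)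

lemma fg_eq_inv: "fg_eq u v \<Longrightarrow> fg_eq (fg_inv u) (fg_inv v)"
proof (induction rule: fg_eq.induct)
  case (cancel u x b v)
  show ?case using fg_eq.cancel[of "fg_inv v" x b "fg_inv u"] by simp
qed (blast intro: fg_eq.intros)+

instantiation free_group :: (type) "{monoid_mult, inverse}"
begin

lift_definition one_free_group :: "'a free_group" is "[]" .

lift_definition times_free_group :: "'a free_group \<Rightarrow> 'a free_group \<Rightarrow> 'a free_group" is "(@)"
  by (rule fg_eq_append)

lift_definition inverse_free_group :: "'a free_group \<Rightarrow> 'a free_group" is fg_inv
  by (rule fg_eq_inv)

definition divide_free_group :: "'a free_group \<Rightarrow> 'a free_group \<Rightarrow> 'a free_group" where
  "divide_free_group x y = x * inverse y"

instance
proof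
  fix x y z :: "'a free_group"
  show "x * y * z = x * (y * z)" "1 * x = x" "x * 1 = x"
    by (transfer, simp add: fg_eq.refl)+
qed

end

lemma free_group_right_inverse: "x * inverse x = 1" for x :: "'a free_group"
proof transfer
  fix u :: "('a \<times> bool) list"
  show "fg_eq (u @ fg_inv u) []"
  proof (induction u)
    case (Cons a u)
    obtain x b where a: "a = (x, b)" by fastforce
    have "fg_eq ([a] @ (u @ fg_inv u) @ [(x, \<not> b)]) ([a] @ [] @ [(x, \<not> b)])"
      using Cons by (rule fg_eq_context)
    then show ?case using fg_eq.cancel[of "[]" x b "[]"] a by (auto intro: fg_eq.trans)
  qed (simp add: fg_eq.refl)
qed

lemma free_group_left_inverse: "inverse x * x = 1" for x :: "'a free_group"
proof -
  have "inverse (inverse x) = x"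
    by transfer (simp add: fg_inv_def rev_map comp_def case_prod_unfold fg_eq.refl)
  then show ?thesis using free_group_right_inverse[of "inverse x"] by simp
qed

text \<open>
  A word as an element of the free group. In the theorem the radix point is a further free
  generator; its inverse never occurs there, so it is never cancelled.
\<close>

lift_definition fg_word :: "'a list \<Rightarrow> 'a free_group" is "map (\<lambda>x. (x, True))" .

lemma fg_word_append: "fg_word (u @ v) = fg_word u * fg_word v"
  by transfer (simp add: fg_eq.refl)

text \<open>
  Equality of (positive) words in the free group is equality of words, so nothing is lost
  by comparing words there. The proof uses the reduced form of a signed word.
\<close>

fun fg_push :: "'a \<times> bool \<Rightarrow> ('a \<times> bool) list \<Rightarrow> ('a \<times> bool) list" where
  "fg_push a [] = [a]"
| "fg_push a (c # w) = (if fst c = fst a \<and> snd c \<noteq> snd a then w else a # c # w)"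

definition fg_reduce :: "('a \<times> bool) list \<Rightarrow> ('a \<times> bool) list" where
  "fg_reduce u = foldr fg_push u []"

fun fg_reduced :: "('a \<times> bool) list \<Rightarrow> bool" where
  "fg_reduced (a # c # w) \<longleftrightarrow> \<not> (fst c = fst a \<and> snd c \<noteq> snd a) \<and> fg_reduced (c # w)"
| "fg_reduced _ \<longleftrightarrow> True"

lemma fg_reduced_push: "fg_reduced w \<Longrightarrow> fg_reduced (fg_push a w)"
  by (induction w rule: fg_reduced.induct) auto

lemma fg_reduced_foldr: "fg_reduced (foldr fg_push u [])"
  by (induction u) (auto intro: fg_reduced_push)

lemma fg_push_push: "fg_reduced w \<Longrightarrow> fg_push (x, b) (fg_push (x, \<not> b) w) = w"
  by (induction w rule: fg_reduced.induct) auto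

lemma fg_reduce_cong: "fg_eq u v \<Longrightarrow> fg_reduce u = fg_reduce v"
  by (induction rule: fg_eq.induct)
    (simp_all add: fg_reduce_def fg_push_push fg_reduced_foldr)

lemma fg_reduce_positive: "fg_reduce (map (\<lambda>x. (x, True)) u) = map (\<lambda>x. (x, True)) u"
proof (induction u)
  case (Cons x u)
  then show ?case by (cases u) (simp_all add: fg_reduce_def)
qed (simp add: fg_reduce_def)

lemma fg_word_inject: "fg_word u = fg_word v \<longleftrightarrow> u = v"
proof
  assume "fg_word u = fg_word v"
  then have "fg_eq (map (\<lambda>x. (x, True)) u) (map (\<lambda>x. (x, True)) v)"
    by transfer
  from fg_reduce_cong[OF this] have "map (\<lambda>x. (x, True)) u = map (\<lambda>x. (x, True)) v"
    by (simp add: fg_reduce_positive)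
  then show "u = v" by (simp add: inj_map_eq_map inj_on_def)
qed simp

end

theory Submission
  imports Defs
begin

text \<open>
  Since \<open>L n = \<phi> ^ n + (- 1 / \<phi>) ^ n\<close>, adding a suitable Lucas number to
  an expansion \<open>10w\<cdot>v01\<close> whose outermost digits sit at a matching distance from the point
  changes its value only near the two ends: the prefix \<open>10\<close> and the suffix \<open>01\<close> are replaced
  and \<open>w\<cdot>v\<close> is kept. The new word again has no factor \<open>11\<close>, so by uniqueness it is the
  expansion of the sum. By induction all expansions over a Lucas interval have this shape.
\<close>

section \<open>Arithmetic of powers of \<open>phi\<close> and of Lucas numbers\<close>

lemma phi_gt_1: "phi > 1"
  by (simp add: phi_def)

lemma phi_nonzero [simp]: "phi \<noteq> 0"
  using phi_gt_1 by simp

lemma phi_mult_self: "phi * phi = phi + 1"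
  by (simp add: phi_def field_simps)

lemma phi_powi_add2: "phi powi (i + 2) = phi powi (i + 1) + phi powi i"
  using phi_mult_self by (simp add: power_int_add power2_eq_square algebra_simps)

text \<open>Every small power becomes an integer combination of 1 and \<open>phi\<close>. Once a
  factor \<open>phi powi (2 * m)\<close> or its inverse is split off, identities between powers
  reduce to linear arithmetic.\<close>

lemma phi_powers:
  "phi ^ 2 = phi + 1" "phi ^ 3 = 2 * phi + 1" "phi ^ 4 = 3 * phi + 2"
  "inverse phi = phi - 1" "phi powi (- 2) = 2 - phi" "phi powi (- 3) = 2 * phi - 3"
  "phi powi (- 4) = 5 - 3 * phi"
proof -
  show "phi ^ 2 = phi + 1" "inverse phi = phi - 1"
    using phi_mult_self by (simp_all add: power2_eq_square field_simps)
  then show "phi ^ 3 = 2 * phi + 1" "phi powi (- 2) = 2 - phi"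
    using phi_powi_add2[of 1] phi_powi_add2[of "-2"] by simp_all
  then show "phi ^ 4 = 3 * phi + 2" "phi powi (- 3) = 2 * phi - 3"
    using phi_powi_add2[of 2] phi_powi_add2[of "-3"] \<open>phi ^ 2 = _\<close> \<open>inverse phi = _\<close> by simp_all
  then show "phi powi (- 4) = 5 - 3 * phi"
    using phi_powi_add2[of "-4"] \<open>phi powi (-2) = _\<close> by simp
qed

text \<open>The \<open>NO_MATCH\<close> premise keeps these rewrite rules from looping at \<open>c = 0\<close>.\<close>

lemma phi_powi_2m:
  assumes "NO_MATCH 0 c"
  shows "phi powi (int m * 2 + c) = phi powi (int m * 2) * phi powi c"
    "phi powi (c + int m * 2) = phi powi (int m * 2) * phi powi c"
    "phi powi (c - int m * 2) = phi powi (- (int m * 2)) * phi powi c"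
    "phi powi (- (int m * 2) - c) = phi powi (- (int m * 2)) * phi powi (- c)"
  by (simp_all add: power_int_add power_int_diff power_int_minus field_simps)

text \<open>Binet's formula with the sign of \<open>(- 1 / phi) ^ n\<close> resolved by parity. Both
  parities go together because each induction step raises the index by two.\<close>

lemma lucas_closed_form:
  "lucas (2 * m) = phi powi (2 * int m) + phi powi (- (2 * int m)) \<and>
   lucas (2 * m + 1) = phi powi (2 * int m + 1) - phi powi (- (2 * int m) - 1)"
proof (induction m)
  case 0
  show ?case by (simp add: phi_powers)
next
  case (Suc m)
  then show ?case by (simp add: phi_powi_2m phi_powers algebra_simps)
qed

lemma lucas_shift:
  "lucas (2 + m) = lucas m + lucas (Suc m)"
  "lucas (3 + m) = lucas m + 2 * lucas (Suc m)"
  "lucas (4 + m) = 2 * lucas m + 3 * lucas (Suc m)"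
  "lucas (5 + m) = 3 * lucas m + 5 * lucas (Suc m)"
  by (simp_all add: eval_nat_numeral)

subsection \<open>Uniqueness of base phi expansions\<close>

text \<open>A 1 at the top index \<open>m - 1\<close> forces a 0 at \<open>m - 2\<close>, and the
  digits below contribute less than \<open>phi powi (m - 2)\<close>; together they stay below
  \<open>phi powi m\<close>. Dropping two places at once calls for strong induction.\<close>

lemma expansion_tail_less:
  fixes e :: "int \<Rightarrow> nat"
  assumes "\<And>i. e i \<in> {0, 1}" and "\<And>i. e i * e (i + 1) = 0"
  shows "(\<Sum>i\<in>{m - int k..<m}. real (e i) * phi powi i) < phi powi m"
proof (induction k arbitrary: m rule: less_induct)
  case (less k)
  have pos: "phi powi i > 0" for i using phi_gt_1 by simp
  show ?case
  proof (cases k)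
    case 0
    then show ?thesis using pos by simp
  next
    case (Suc j)
    have "{m - int k..<m} = insert (m - 1) {(m - 1) - int j..<m - 1}" using Suc by auto
    then have split: "(\<Sum>i\<in>{m - int k..<m}. real (e i) * phi powi i) =
      real (e (m - 1)) * phi powi (m - 1) + (\<Sum>i\<in>{(m - 1) - int j..<m - 1}. real (e i) * phi powi i)"
      by simp
    have rec: "phi powi m = phi powi (m - 1) + phi powi (m - 2)"
      using phi_powi_add2[of "m - 2"] by simp
    show ?thesis
    proof (cases "e (m - 1) = 0")
      case True
      then show ?thesis using split less.IH[of j "m - 1"] Suc rec pos[of "m - 2"] by simp
    next
      case False
      then have one: "e (m - 1) = 1" using assms(1)[of "m - 1"] by auto
      have zero: "e (m - 2) = 0" using assms(2)[of "m - 2"] one by simp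
      show ?thesis
      proof (cases j)
        case 0
        then show ?thesis using split one rec pos[of "m - 2"] by simp
      next
        case (Suc l)
        have "{(m - 1) - int j..<m - 1} = insert (m - 2) {(m - 2) - int l..<m - 2}"
          using Suc by auto
        then have "(\<Sum>i\<in>{(m - 1) - int j..<m - 1}. real (e i) * phi powi i) < phi powi (m - 2)"
          using less.IH[of l "m - 2"] \<open>k = Suc j\<close> Suc zero by simp
        then show ?thesis using split one rec by simp
      qed
    qed
  qed
qed

text \<open>At the highest index where two expansions differ, one has 1 and the other 0. By
  \<open>expansion_tail_less\<close> the lower digits of the latter cannot make up for the missing
  power.\<close>

lemma base_phi_expansion_unique:
  assumes d: "is_base_phi_expansion N d" and e: "is_base_phi_expansion N e"
  shows "d = e"
proof (rule ccontr)
  let ?D = "{i. d i \<noteq> e i}" and ?S = "{i. d i \<noteq> 0} \<union> {i. e i \<noteq> 0}"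
  assume "d \<noteq> e"
  then have "?D \<noteq> {}" by auto
  have finS: "finite ?S" using d e by (auto simp: is_base_phi_expansion_def)
  moreover have "?D \<subseteq> ?S" by auto
  ultimately have finD: "finite ?D" using finite_subset by blast
  define m where "m = Max ?D"
  have m: "d m \<noteq> e m" using Max_in[OF finD \<open>?D \<noteq> {}\<close>] by (simp add: m_def)
  have above: "d i = e i" if "i > m" for i
    using Max_ge[OF finD, of i] that by (force simp: m_def)
  define lo hi where "lo = Min (insert m ?S)" and "hi = Max (insert m ?S)"
  have lo: "\<And>i. i \<in> ?S \<Longrightarrow> lo \<le> i" "lo \<le> m" and hi: "\<And>i. i \<in> ?S \<Longrightarrow> i \<le> hi" "m \<le> hi"
    using finS unfolding lo_def hi_def by (auto intro!: Min_le Max_ge)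
  have split: "real_of_int N = (\<Sum>i\<in>{lo..<m}. real (c i) * phi powi i) + real (c m) * phi powi m
      + (\<Sum>i\<in>{m<..hi}. real (c i) * phi powi i)"
    if "is_base_phi_expansion N c" "{i. c i \<noteq> 0} \<subseteq> ?S" for c
  proof -
    have "real_of_int N = (\<Sum>i | c i \<noteq> 0. real (c i) * phi powi i)"
      using that(1) by (simp add: is_base_phi_expansion_def)
    also have "\<dots> = (\<Sum>i\<in>{lo..hi}. real (c i) * phi powi i)"
      using that(2) lo hi by (intro sum.mono_neutral_left) auto
    also have "{lo..hi} = {lo..<m} \<union> {m} \<union> {m<..hi}" using lo hi by auto
    also have "sum f ({lo..<m} \<union> {m} \<union> {m<..hi}) = sum f {lo..<m} + f m + sum f {m<..hi}"
      for f :: "int \<Rightarrow> real"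
      by (subst sum.union_disjoint; (subst sum.union_disjoint)?; force)
    finally show ?thesis .
  qed
  \<comment> \<open>Stated for arbitrary \<open>b\<close> and \<open>c\<close>, so that it serves
    whichever of \<open>d\<close> and \<open>e\<close> has the digit 1 at \<open>m\<close>.\<close>
  have no_carry: False
    if "is_base_phi_expansion N b" "is_base_phi_expansion N c" "b m = 1" "c m = 0"
      "{i. b i \<noteq> 0} \<subseteq> ?S" "{i. c i \<noteq> 0} \<subseteq> ?S" "\<And>i. i > m \<Longrightarrow> b i = c i" for b c
  proof -
    have "(\<Sum>i\<in>{m<..hi}. real (b i) * phi powi i) = (\<Sum>i\<in>{m<..hi}. real (c i) * phi powi i)"
      using that(7) by (intro sum.cong) auto
    moreover have "0 \<le> (\<Sum>i\<in>{lo..<m}. real (b i) * phi powi i)"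
      using phi_gt_1 by (intro sum_nonneg) auto
    moreover have "(\<Sum>i\<in>{lo..<m}. real (c i) * phi powi i) < phi powi m"
      using expansion_tail_less[of c m "nat (m - lo)"] that(2) lo(2)
      by (simp add: is_base_phi_expansion_def)
    ultimately show False using split[OF that(1,5)] split[OF that(2,6)] that(3,4) by simp
  qed
  have "d m \<in> {0, 1}" "e m \<in> {0, 1}" using d e by (auto simp: is_base_phi_expansion_def)
  with m consider "d m = 1" "e m = 0" | "e m = 1" "d m = 0" by auto
  then show False
  proof cases
    case 1
    then show False using no_carry[OF d e] above by auto
  next
    case 2
    then show False using no_carry[OF e d] above by auto
  qed
qed

lemma phi_digit_eqI: "is_base_phi_expansion N d \<Longrightarrow> phi_digit N = d"
  unfolding phi_digit_def by (blast intro: base_phi_expansion_unique)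

subsection \<open>Reading off the expansion from a word\<close>

fun letter_digit :: "letter \<Rightarrow> nat" where
  "letter_digit D1 = 1"
| "letter_digit _ = 0"

text \<open>Words are evaluated with the radix point left out: \<open>a\<close> is the exponent of
  the first letter, and this fixes where the point stands.\<close>

fun word_value :: "int \<Rightarrow> letter list \<Rightarrow> real" where
  "word_value a [] = 0"
| "word_value a (x # s) = real (letter_digit x) * phi powi a + word_value (a - 1) s"

lemma word_value_append:
  "word_value a (s @ t) = word_value a s + word_value (a - int (length s)) t"
  by (induction s arbitrary: a) (simp_all add: algebra_simps)

lemma successively_nth: "successively P xs \<Longrightarrow> Suc i < length xs \<Longrightarrow> P (xs ! i) (xs ! Suc i)"
proof (induction xs arbitrary: i)
  case (Cons x xs)
  then show ?case by (cases i; cases xs) (auto simp: successively_Cons)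
qed simp

abbreviation no_11 :: "letter list \<Rightarrow> bool" where
  "no_11 \<equiv> successively (\<lambda>x y. \<not> (x = D1 \<and> y = D1))"

text \<open>The guard \<open>i \<le> a\<close> matters: \<open>nat (a - i)\<close> is 0 for every
  \<open>i > a\<close>, which would read the first letter.\<close>

definition word_digit :: "int \<Rightarrow> letter list \<Rightarrow> int \<Rightarrow> nat" where
  "word_digit a s i =
     (if i \<le> a \<and> nat (a - i) < length s then letter_digit (s ! nat (a - i)) else 0)"

lemma word_digit_support: "{i. word_digit a s i \<noteq> 0} \<subseteq> {a - int (length s)<..a}"
  by (auto simp: word_digit_def split: if_splits)

lemma word_value_eq_sum:
  "word_value a s = (\<Sum>i\<in>{a - int (length s)<..a}. real (word_digit a s i) * phi powi i)"
proof (induction s arbitrary: a)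
  case (Cons x s)
  have "{a - int (length (x # s))<..a} = insert a {(a - 1) - int (length s)<..a - 1}"
    by auto
  moreover have "word_digit a (x # s) i = word_digit (a - 1) s i" if "i \<le> a - 1" for i
  proof -
    have "nat (a - i) = Suc (nat (a - 1 - i))" using that by simp
    then show ?thesis using that by (simp add: word_digit_def)
  qed
  moreover have "word_digit a (x # s) a = letter_digit x"
    by (simp add: word_digit_def)
  ultimately show ?case using Cons[of "a - 1"] by simp
qed simp

lemma base_phi_expansion_word_digit:
  assumes "no_11 s" and "word_value a s = real_of_int N"
  shows "is_base_phi_expansion N (word_digit a s)"
  unfolding is_base_phi_expansion_def
proof (intro conjI allI)
  have letter: "letter_digit x \<in> {0, 1}" for x by (cases x) auto
  then show "word_digit a s i \<in> {0, 1}" for i by (simp add: word_digit_def)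
  show "finite {i. word_digit a s i \<noteq> 0}"
    using word_digit_support by (rule finite_subset) simp
  show "word_digit a s i * word_digit a s (i + 1) = 0" for i
  proof (rule ccontr)
    assume "\<not> ?thesis"
    then have i: "i + 1 \<le> a" "nat (a - i) < length s"
      and nz: "letter_digit (s ! nat (a - i)) \<noteq> 0" "letter_digit (s ! nat (a - (i + 1))) \<noteq> 0"
      by (auto simp: word_digit_def split: if_splits)
    have "nat (a - i) = Suc (nat (a - (i + 1)))" using i by simp
    moreover have "x = D1" if "letter_digit x \<noteq> 0" for x using that by (cases x) auto
    ultimately show False
      using i nz successively_nth[OF assms(1), of "nat (a - (i + 1))"] by simp
  qed
  show "real_of_int N = (\<Sum>i | word_digit a s i \<noteq> 0. real (word_digit a s i) * phi powi i)"
    unfolding assms(2)[symmetric] word_value_eq_sum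
    using word_digit_support by (intro sum.mono_neutral_right) auto
qed

lemma digit_letter_digit: "x \<in> {D0, D1} \<Longrightarrow> digit_letter (letter_digit x) = x"
  by (auto simp: digit_letter_def)

text \<open>An initial and a final 1 pin down the extreme indices as \<open>length u - 1\<close> and
  \<open>- length v\<close>, so \<open>beta\<close> lists exactly \<open>u\<close> and
  \<open>v\<close>; uniqueness identifies the digits.\<close>

lemma beta_eqI:
  assumes digits: "set u \<union> set v \<subseteq> {D0, D1}" and "no_11 (u @ v)"
    and val: "word_value (int (length u) - 1) (u @ v) = real_of_int N"
    and hd: "u \<noteq> []" "hd u = D1" and last: "v \<noteq> []" "last v = D1"
  shows "beta N = u @ Point # v"
proof -
  define a where "a = int (length u) - 1"
  define d where "d = word_digit a (u @ v)"
  have d: "phi_digit N = d"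
    unfolding d_def a_def by (rule phi_digit_eqI[OF base_phi_expansion_word_digit[OF assms(2) val]])
  have "{i. d i = 1} \<subseteq> {i. d i \<noteq> 0}" by auto
  also have "\<dots> \<subseteq> {- int (length v)..a}"
    using word_digit_support[of a "u @ v"] by (auto simp: d_def a_def)
  finally have supp: "{i. d i = 1} \<subseteq> {- int (length v)..a}" .
  then have fin: "finite {i. d i = 1}" by (rule finite_subset) simp
  have "d a = 1" using hd by (simp add: d_def word_digit_def hd_append flip: hd_conv_nth)
  then have L: "Max {i. d i = 1} = a" using fin supp by (intro Max_eqI) auto
  \<comment> \<open>The first letter after the point has index -1, hence the offset
    \<open>i - 1\<close>.\<close>
  have dv: "d (- i) = letter_digit (v ! nat (i - 1))" if "1 \<le> i" "i \<le> int (length v)" for i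
  proof -
    have "nat (a + i) = length u + nat (i - 1)" "nat (i - 1) < length v"
      using that by (simp_all add: a_def)
    then show ?thesis using that by (simp add: d_def word_digit_def a_def nth_append)
  qed
  have "nat (int (length v) - 1) = length v - 1" by linarith
  then have "v ! nat (int (length v) - 1) = D1"
    using last by (simp add: last_conv_nth)
  then have "d (- int (length v)) = 1"
    using dv[of "int (length v)"] last by (cases v) auto
  then have R: "Min {i. d i = 1} = - int (length v)"
    using fin supp by (intro Min_eqI) auto
  have "map (\<lambda>i. digit_letter (d i)) (rev [0..a]) = u"
  proof (rule nth_equalityI)
    show len: "length (map (\<lambda>i. digit_letter (d i)) (rev [0..a])) = length u"
      by (simp add: a_def)
    fix i assume "i < length (map (\<lambda>i. digit_letter (d i)) (rev [0..a]))"
    then have i: "i < length u" using len by simp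
    then have "rev [0..a] ! i = a - int i"
      by (simp add: rev_nth a_def)
    moreover have "u ! i \<in> {D0, D1}" using i digits nth_mem by blast
    ultimately show "map (\<lambda>i. digit_letter (d i)) (rev [0..a]) ! i = u ! i"
      using i by (simp add: d_def word_digit_def nth_append digit_letter_digit a_def)
  qed
  moreover have "map (\<lambda>i. digit_letter (d (- i))) [1..int (length v)] = v"
  proof (rule nth_equalityI)
    fix i assume "i < length (map (\<lambda>i. digit_letter (d (- i))) [1..int (length v)])"
    then have i: "i < length v" by simp
    moreover have "v ! i \<in> {D0, D1}" using i digits nth_mem by blast
    ultimately show "map (\<lambda>i. digit_letter (d (- i))) [1..int (length v)] ! i = v ! i"
      using dv[of "1 + int i"] by (simp add: digit_letter_digit)
  qed simp
  ultimately show ?thesis unfolding beta_def Let_def d L R by simp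
qed

subsection \<open>Shape of the expansions on a Lucas interval\<close>

text \<open>
  The expansion is \<open>10w\<cdot>v01\<close>. The last clause is what allows the suffix \<open>01\<close> of
  an expansion on an odd interval to be replaced by \<open>1001\<close>.
\<close>

definition phi_form :: "nat \<Rightarrow> int \<Rightarrow> letter list \<Rightarrow> letter list \<Rightarrow> bool" where
  "phi_form k N w v \<longleftrightarrow>
     set w \<union> set v \<subseteq> {D0, D1} \<and> no_11 ([D1, D0] @ w @ v @ [D0, D1]) \<and>
     length w + 1 = k \<and> length v + 2 = 2 * ((k + 1) div 2) \<and>
     word_value (int k) ([D1, D0] @ w @ v @ [D0, D1]) = real_of_int N \<and>
     (odd k \<longrightarrow> last (D0 # w @ v) = D0)"

lemma beta_phi_form:
  assumes "phi_form k N w v"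
  shows "beta N = [D1, D0] @ w @ [Point] @ v @ [D0, D1]"
  using assms beta_eqI[of "[D1, D0] @ w" "v @ [D0, D1]" N] by (auto simp: phi_form_def)

text \<open>\<open>2 * ((k + 1) div 2)\<close> is \<open>k\<close> rounded up to an even number. The
  two outer ones sit at index \<open>k\<close> and at minus this number; \<open>w @ v\<close> starts
  at \<open>k - 2\<close>.\<close>

lemma phi_form_value:
  assumes "phi_form k N w v"
  shows "real_of_int N = phi powi int k + word_value (int k - 2) (w @ v)
    + phi powi (- (2 * int ((k + 1) div 2)))"
proof -
  have "int (length w) + int (length v) = int k + 2 * int ((k + 1) div 2) - 3"
    using assms by (auto simp: phi_form_def)
  then show ?thesis
    using assms by (simp add: phi_form_def word_value_append algebra_simps)
qed

text \<open>The lengths of \<open>p\<close> and \<open>s\<close> keep \<open>w\<close> and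
  \<open>v\<close> at their old positions, so only the two ends enter \<open>val\<close>, where the
  old outer ones are subtracted. No 11 arises at a junction: \<open>p\<close> ends in 0, and
  \<open>s\<close> may begin with 1 only for odd \<open>k\<close>, when \<open>w @ v\<close> does
  not end in 1.\<close>

lemma phi_form_extend:
  assumes form: "phi_form k M w v"
    and k': "k' = k + length p" "length s + 2 * ((k + 1) div 2) = 2 * ((k' + 1) div 2)"
    and letters: "set p \<union> set s \<subseteq> {D0, D1}"
    and p: "p \<noteq> []" "last p = D0" "no_11 p"
    and s: "s \<noteq> []" "no_11 (s @ [D0])" "hd s = D1 \<longrightarrow> odd k" "odd k' \<longrightarrow> last s = D0"
    and val: "real_of_int N - real_of_int M =
      phi powi int k' - phi powi int k + word_value (int k' - 2) p
      + word_value (1 - 2 * int ((k + 1) div 2)) s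
      + phi powi (- (2 * int ((k' + 1) div 2))) - phi powi (- (2 * int ((k + 1) div 2)))"
  shows "phi_form k' N (p @ w) (v @ s)"
proof -
  \<comment> \<open>The leading 0 of \<open>t\<close> stands for the last letter of
    \<open>p\<close>, which precedes \<open>w\<close>; it also gives \<open>last t\<close> a value
    when \<open>w @ v\<close> is empty.\<close>
  define t where "t = D0 # w @ v"
  have len: "int (length w) + int (length v) = int k + 2 * int ((k + 1) div 2) - 3"
    "int k' = int k + int (length p)"
    "int (length s) = 2 * int ((k' + 1) div 2) - 2 * int ((k + 1) div 2)"
    using form k' by (auto simp: phi_form_def)
  have t: "no_11 t" "odd k \<longrightarrow> last t = D0"
    using form by (auto simp: phi_form_def t_def successively_append_iff successively_Cons split: if_splits)
  obtain q where q: "p = q @ [D0]" using p by (metis append_butlast_last_id)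
  have "no_11 (D1 # D0 # q @ t @ s @ [D0, D1])"
    using t p(3) s by (auto simp: q successively_append_iff successively_Cons t_def hd_append)
  moreover have "D1 # D0 # q @ t @ s @ [D0, D1] = [D1, D0] @ (p @ w) @ (v @ s) @ [D0, D1]"
    by (simp add: q t_def)
  moreover have "word_value (int k') ([D1, D0] @ (p @ w) @ (v @ s) @ [D0, D1]) = real_of_int N"
  proof -
    define r where "r = w @ v"
    have pos: "int k' - int (length [D1, D0]) = int k' - 2" "int k' - 2 - int (length p) = int k - 2"
      "int k - 2 - int (length r) = 1 - 2 * int ((k + 1) div 2)"
      "1 - 2 * int ((k + 1) div 2) - int (length s) = 1 - 2 * int ((k' + 1) div 2)"
      using len by (simp_all add: r_def)
    have "word_value (int k') ([D1, D0] @ p @ r @ s @ [D0, D1]) =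
      word_value (int k') [D1, D0] + (word_value (int k' - 2) p + (word_value (int k - 2) r
        + (word_value (1 - 2 * int ((k + 1) div 2)) s
        + word_value (1 - 2 * int ((k' + 1) div 2)) [D0, D1])))"
      unfolding word_value_append pos ..
    then show ?thesis using phi_form_value[OF form] val by (simp add: r_def)
  qed
  ultimately show ?thesis
    using form k' letters s by (auto simp: phi_form_def)
qed

section \<open>Replacing the outer digits: the six cases of the recursion\<close>

lemma phi_form_odd_a:
  assumes "phi_form (2 * m + 1) M w v"
  shows "phi_form (2 * m + 3) (M + lucas (2 * m + 2)) (D0 # D0 # w) (v @ [D1, D0])"
  \<comment> \<open>The left end gains \<open>phi^(2m+3) - phi^(2m+1) = phi^(2m+2)\<close>, the
    right end \<open>phi^(-2m-1) - phi^(-2m-2) + phi^(-2m-4) = phi^(-2m-2)\<close>; the sum is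
    \<open>lucas (2 * m + 2)\<close>.\<close>
  using phi_form_extend[OF assms, of "2 * m + 3" "[D0, D0]" "[D1, D0]" "M + lucas (2 * m + 2)"]
    lucas_closed_form[of m]
  by (simp add: lucas_shift phi_powi_2m phi_powers algebra_simps)

lemma phi_form_odd_b:
  assumes "phi_form (2 * m) M w v"
  shows "phi_form (2 * m + 3) (M + lucas (2 * m + 3)) (D0 # D1 # D0 # w) (v @ [D0, D0, D1, D0])"
  \<comment> \<open>The 1 in \<open>[D0, D1, D0]\<close> is the old leading 1, so the left end gains
    \<open>phi^(2m+3)\<close>. On the right the 1 at index \<open>-2m\<close> gives way to ones at
    \<open>-2m-1\<close> and \<open>-2m-4\<close>, a loss of \<open>phi^(-2m-3)\<close>.\<close>
  using phi_form_extend[OF assms, of "2 * m + 3" "[D0, D1, D0]" "[D0, D0, D1, D0]" "M + lucas (2 * m + 3)"]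
    lucas_closed_form[of m]
  by (simp add: lucas_shift phi_powi_2m phi_powers algebra_simps)

lemma phi_form_odd_c:
  assumes "phi_form (2 * m + 1) M w v"
  shows "phi_form (2 * m + 3) (M + lucas (2 * m + 3)) (D1 # D0 # w) (v @ [D0, D0])"
  using phi_form_extend[OF assms, of "2 * m + 3" "[D1, D0]" "[D0, D0]" "M + lucas (2 * m + 3)"]
    lucas_closed_form[of m]
  by (simp add: lucas_shift phi_powi_2m phi_powers algebra_simps)

lemma phi_form_even_a:
  assumes "phi_form (2 * m + 2) M w v"
  shows "phi_form (2 * m + 4) (M + lucas (2 * m + 3)) (D0 # D0 # w) (v @ [D0, D0])"
  \<comment> \<open>Each outer 1 moves outward by two places: a gain of \<open>phi^(2m+3)\<close> on
    the left and a loss of \<open>phi^(-2m-3)\<close> on the right.\<close>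
  using phi_form_extend[OF assms, of "2 * m + 4" "[D0, D0]" "[D0, D0]" "M + lucas (2 * m + 3)"]
    lucas_closed_form[of m]
  by (simp add: lucas_shift phi_powi_2m phi_powers algebra_simps)

text \<open>The old word survives whole inside the new one; the two new outer ones add
  \<open>lucas (2 * m + 4)\<close>.\<close>

lemma phi_form_even_b:
  assumes "phi_form (2 * m + 1) M w v"
  shows "phi_form (2 * m + 4) (M + lucas (2 * m + 4)) (D0 # D1 # D0 # w) (v @ [D0, D1])"
  using phi_form_extend[OF assms, of "2 * m + 4" "[D0, D1, D0]" "[D0, D1]" "M + lucas (2 * m + 4)"]
    lucas_closed_form[of m]
  by (simp add: lucas_shift phi_powi_2m phi_powers algebra_simps)

lemma phi_form_even_c:
  assumes "phi_form (2 * m + 2) M w v"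
  shows "phi_form (2 * m + 4) (M + lucas (2 * m + 4)) (D1 # D0 # w) (v @ [D0, D1])"
  using phi_form_extend[OF assms, of "2 * m + 4" "[D1, D0]" "[D0, D1]" "M + lucas (2 * m + 4)"]
    lucas_closed_form[of m]
  by (simp add: lucas_shift phi_powi_2m phi_powers algebra_simps)

section \<open>Splitting a Lucas interval into three translates\<close>

lemma lucas_positive: "lucas (2 * m) > 0 \<and> lucas (2 * m + 1) > 0 \<and> lucas (2 * m) \<le> lucas (2 * m + 1) + 1"
  by (induction m) auto

lemma translate_atLeastAtMost: "translate {a..b} x = {a + x..b + x}" for x :: int
  by (force simp: translate_def intro: exI[of _ "_ - x"])

lemma translate_iff: "N \<in> translate A x \<longleftrightarrow> N - x \<in> A"
  by (force simp: translate_def)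

lemma consecutive_intervalsI:
  assumes "p \<le> q" "q \<le> r" "r \<le> s" "A = {p..q - 1}" "B = {q..r - 1}" "C = {r..s - 1}" "I = {p..s - 1}"
  shows "I = A \<union> B \<union> C \<and> consecutive_intervals A B C \<and> A \<inter> B = {} \<and> A \<inter> C = {} \<and> B \<inter> C = {}"
proof -
  have "consecutive_intervals A B C"
    unfolding consecutive_intervals_def
    using assms by (intro exI[of _ p] exI[of _ q] exI[of _ r] exI[of _ s]) auto
  then show ?thesis using assms by auto
qed

lemma Lucas_interval_odd_split:
  fixes m :: nat
  defines "A \<equiv> translate (\<Lambda> (2 * m + 1)) (lucas (2 * m + 2))"
    and "B \<equiv> translate (\<Lambda> (2 * m)) (lucas (2 * m + 3))"
    and "C \<equiv> translate (\<Lambda> (2 * m + 1)) (lucas (2 * m + 3))"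
  shows "\<Lambda> (2 * m + 3) = A \<union> B \<union> C \<and> consecutive_intervals A B C \<and>
    A \<inter> B = {} \<and> A \<inter> C = {} \<and> B \<inter> C = {}"
  unfolding A_def B_def C_def
  \<comment> \<open>The witnesses are the left endpoints of \<open>A\<close>, \<open>B\<close>,
    \<open>C\<close> and the successor of the right end of \<open>C\<close>, in terms of two
    consecutive Lucas numbers. For \<open>m = 0\<close> the second and third coincide, as
    \<open>B\<close> is empty.\<close>
  by (rule consecutive_intervalsI[of "lucas (2 * m) + 2 * lucas (2 * m + 1) + 1"
        "2 * lucas (2 * m) + 2 * lucas (2 * m + 1)" "lucas (2 * m) + 3 * lucas (2 * m + 1) + 1"
        "2 * lucas (2 * m) + 3 * lucas (2 * m + 1)"])
    (use lucas_positive[of m] in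
      \<open>simp_all add: Lucas_interval_def translate_atLeastAtMost lucas_shift add.commute\<close>)

lemma Lucas_interval_even_split:
  fixes m :: nat
  defines "A \<equiv> translate (\<Lambda> (2 * m + 2)) (lucas (2 * m + 3))"
    and "B \<equiv> translate (\<Lambda> (2 * m + 1)) (lucas (2 * m + 4))"
    and "C \<equiv> translate (\<Lambda> (2 * m + 2)) (lucas (2 * m + 4))"
  shows "\<Lambda> (2 * m + 4) = A \<union> B \<union> C \<and> consecutive_intervals A B C \<and>
    A \<inter> B = {} \<and> A \<inter> C = {} \<and> B \<inter> C = {}"
  unfolding A_def B_def C_def
  by (rule consecutive_intervalsI[of "2 * lucas (2 * m) + 3 * lucas (2 * m + 1)"
        "2 * lucas (2 * m) + 4 * lucas (2 * m + 1) + 1" "3 * lucas (2 * m) + 4 * lucas (2 * m + 1)"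
        "3 * lucas (2 * m) + 5 * lucas (2 * m + 1) + 1"])
    (use lucas_positive[of m] in
      \<open>simp_all add: Lucas_interval_def translate_atLeastAtMost lucas_shift add.commute\<close>)

text \<open>Three consecutive intervals are carried along, because the one at \<open>2m+3\<close>
  splits into translates of those at \<open>2m\<close> and \<open>2m+1\<close>, and the one at
  \<open>2m+4\<close> into translates of those at \<open>2m+1\<close> and
  \<open>2m+2\<close>.\<close>

lemma phi_form_exists:
  "(\<forall>N\<in>\<Lambda> (2 * m). \<exists>w v. phi_form (2 * m) N w v) \<and>
   (\<forall>N\<in>\<Lambda> (2 * m + 1). \<exists>w v. phi_form (2 * m + 1) N w v) \<and>
   (\<forall>N\<in>\<Lambda> (2 * m + 2). \<exists>w v. phi_form (2 * m + 2) N w v)"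
proof (induction m)
  case 0
  \<comment> \<open>These are the expansions 10.01, 100.01 and 101.01 of 2, 3 and 4.\<close>
  have "phi_form 1 2 [] []" "phi_form 2 3 [D0] []" "phi_form 2 4 [D1] []"
    by (simp_all add: phi_form_def phi_powers)
  moreover have "N = 2" if "N \<in> \<Lambda> 1" for N
    using that by (simp add: Lucas_interval_def eval_nat_numeral)
  moreover have "N = 3 \<or> N = 4" if "N \<in> \<Lambda> 2" for N
    using that by (auto simp: Lucas_interval_def eval_nat_numeral)
  moreover have "\<Lambda> 0 = {}" by (simp add: Lucas_interval_def)
  ultimately show ?case by (simp flip: numeral_2_eq_2) blast
next
  case (Suc m)
  have "\<exists>w v. phi_form (2 * m + 3) N w v" if "N \<in> \<Lambda> (2 * m + 3)" for N
  proof -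
    consider "N - lucas (2 * m + 2) \<in> \<Lambda> (2 * m + 1)" | "N - lucas (2 * m + 3) \<in> \<Lambda> (2 * m)"
      | "N - lucas (2 * m + 3) \<in> \<Lambda> (2 * m + 1)"
      using \<open>N \<in> _\<close> Lucas_interval_odd_split[of m] by (auto simp: translate_iff)
    then show ?thesis
    proof cases
      case 1
      then obtain w v where "phi_form (2 * m + 1) (N - lucas (2 * m + 2)) w v" using Suc by blast
      from phi_form_odd_a[OF this] show ?thesis unfolding diff_add_cancel by blast
    next
      case 2
      then obtain w v where "phi_form (2 * m) (N - lucas (2 * m + 3)) w v" using Suc by blast
      from phi_form_odd_b[OF this] show ?thesis unfolding diff_add_cancel by blast
    next
      case 3
      then obtain w v where "phi_form (2 * m + 1) (N - lucas (2 * m + 3)) w v" using Suc by blast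
      from phi_form_odd_c[OF this] show ?thesis unfolding diff_add_cancel by blast
    qed
  qed
  moreover have "\<exists>w v. phi_form (2 * m + 4) N w v" if "N \<in> \<Lambda> (2 * m + 4)" for N
  proof -
    consider "N - lucas (2 * m + 3) \<in> \<Lambda> (2 * m + 2)" | "N - lucas (2 * m + 4) \<in> \<Lambda> (2 * m + 1)"
      | "N - lucas (2 * m + 4) \<in> \<Lambda> (2 * m + 2)"
      using \<open>N \<in> _\<close> Lucas_interval_even_split[of m] by (auto simp: translate_iff)
    then show ?thesis
    proof cases
      case 1
      then obtain w v where "phi_form (2 * m + 2) (N - lucas (2 * m + 3)) w v" using Suc by blast
      from phi_form_even_a[OF this] show ?thesis unfolding diff_add_cancel by blast
    next
      case 2
      then obtain w v where "phi_form (2 * m + 1) (N - lucas (2 * m + 4)) w v" using Suc by blast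
      from phi_form_even_b[OF this] show ?thesis unfolding diff_add_cancel by blast
    next
      case 3
      then obtain w v where "phi_form (2 * m + 2) (N - lucas (2 * m + 4)) w v" using Suc by blast
      from phi_form_even_c[OF this] show ?thesis unfolding diff_add_cancel by blast
    qed
  qed
  moreover have idx: "2 * Suc m = 2 * m + 2" "2 * m + 2 + 1 = 2 * m + 3" "2 * m + 2 + 2 = 2 * m + 4"
    by simp_all
  ultimately show ?case using Suc unfolding idx by blast
qed

subsection \<open>The recursion in the free group\<close>

lemma free_group_cancel:
  "inverse x * (x * y) = y" "x * (inverse x * y) = y" for x y :: "'a free_group"
  by (simp_all add: free_group_left_inverse free_group_right_inverse flip: mult.assoc)

text \<open>With \<open>a @ x @ b\<close> as the expansion of the smaller number, this exchanges the
  prefix \<open>a\<close> for \<open>p\<close> and the suffix \<open>b\<close> for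
  \<open>s\<close>.\<close>

lemma fg_word_replace:
  "fg_word (p @ x @ s) =
    fg_word p * inverse (fg_word a) * fg_word (a @ x @ b) * inverse (fg_word b) * fg_word s"
  by (simp add: fg_word_append mult.assoc free_group_cancel)

lemma fg_word_replace_suffix:
  "fg_word (p @ x @ s) = fg_word p * fg_word (x @ b) * inverse (fg_word b) * fg_word s"
  by (simp add: fg_word_append mult.assoc free_group_cancel)

text \<open>Grouped by the interval of \<open>M\<close> rather than that of the sum, so that one
  shape of \<open>beta M\<close> yields two odd recursions and one even one.\<close>

lemma beta_odd:
  assumes "M \<in> \<Lambda> (2 * m + 1)"
  shows "fg_word (beta (M + lucas (2 * m + 2))) =
      fg_word [D1, D0, D0, D0] * inverse (fg_word [D1, D0]) * fg_word (beta M) *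
      inverse (fg_word [D0, D1]) * fg_word [D1, D0, D0, D1]"
    and "fg_word (beta (M + lucas (2 * m + 3))) =
      fg_word [D1, D0] * fg_word (beta M) * inverse (fg_word [D0, D1]) * fg_word [D0, D0, D0, D1]"
    and "fg_word (beta (M + lucas (2 * m + 4))) =
      fg_word [D1, D0, D0] * fg_word (beta M) * fg_word [D0, D1]"
proof -
  obtain w v where form: "phi_form (2 * m + 1) M w v"
    using phi_form_exists[of m] assms by blast
  note M = beta_phi_form[OF form]
  show "fg_word (beta (M + lucas (2 * m + 2))) =
      fg_word [D1, D0, D0, D0] * inverse (fg_word [D1, D0]) * fg_word (beta M) *
      inverse (fg_word [D0, D1]) * fg_word [D1, D0, D0, D1]"
    using fg_word_replace[of "[D1, D0, D0, D0]" "w @ [Point] @ v" "[D1, D0, D0, D1]" "[D1, D0]" "[D0, D1]"]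
    unfolding M beta_phi_form[OF phi_form_odd_a[OF form]] by simp
  show "fg_word (beta (M + lucas (2 * m + 3))) =
      fg_word [D1, D0] * fg_word (beta M) * inverse (fg_word [D0, D1]) * fg_word [D0, D0, D0, D1]"
    using fg_word_replace_suffix[of "[D1, D0]" "[D1, D0] @ w @ [Point] @ v" "[D0, D0, D0, D1]" "[D0, D1]"]
    unfolding M beta_phi_form[OF phi_form_odd_c[OF form]] by simp
  show "fg_word (beta (M + lucas (2 * m + 4))) =
      fg_word [D1, D0, D0] * fg_word (beta M) * fg_word [D0, D1]"
    unfolding M beta_phi_form[OF phi_form_even_b[OF form]] by (simp flip: fg_word_append)
qed

lemma beta_even:
  assumes "M \<in> \<Lambda> (2 * m)"
  shows "fg_word (beta (M + lucas (2 * m + 1))) =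
      fg_word [D1, D0, D0, D0] * inverse (fg_word [D1, D0]) * fg_word (beta M) *
      inverse (fg_word [D0, D1]) * fg_word [D0, D0, D0, D1]"
    and "fg_word (beta (M + lucas (2 * m + 2))) =
      fg_word [D1, D0] * fg_word (beta M) * fg_word [D0, D1]"
    and "fg_word (beta (M + lucas (2 * m + 3))) =
      fg_word [D1, D0, D0] * fg_word (beta M) *
      inverse (fg_word [D0, D1]) * fg_word [D0, D0, D1, D0, D0, D1]"
proof -
  obtain w v where form: "phi_form (2 * m) M w v"
    using phi_form_exists[of m] assms by blast
  \<comment> \<open>The shape is impossible at index 0, where it would demand
    \<open>length w + 1 = 0\<close>.\<close>
  then obtain l where l: "m = Suc l" by (cases m) (auto simp: phi_form_def)
  then have form': "phi_form (2 * l + 2) M w v" using form by simp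
  note M = beta_phi_form[OF form]
  have idx: "2 * m + 1 = 2 * l + 3" "2 * m + 2 = 2 * l + 4" using l by simp_all
  show "fg_word (beta (M + lucas (2 * m + 1))) =
      fg_word [D1, D0, D0, D0] * inverse (fg_word [D1, D0]) * fg_word (beta M) *
      inverse (fg_word [D0, D1]) * fg_word [D0, D0, D0, D1]"
    using fg_word_replace[of "[D1, D0, D0, D0]" "w @ [Point] @ v" "[D0, D0, D0, D1]" "[D1, D0]" "[D0, D1]"]
    unfolding idx M beta_phi_form[OF phi_form_even_a[OF form']] by simp
  show "fg_word (beta (M + lucas (2 * m + 2))) =
      fg_word [D1, D0] * fg_word (beta M) * fg_word [D0, D1]"
    unfolding idx M beta_phi_form[OF phi_form_even_c[OF form']] by (simp flip: fg_word_append)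
  show "fg_word (beta (M + lucas (2 * m + 3))) =
      fg_word [D1, D0, D0] * fg_word (beta M) *
      inverse (fg_word [D0, D1]) * fg_word [D0, D0, D1, D0, D0, D1]"
    using fg_word_replace_suffix[of "[D1, D0, D0]" "[D1, D0] @ w @ [Point] @ v"
        "[D0, D0, D1, D0, D0, D1]" "[D0, D1]"]
    unfolding M beta_phi_form[OF phi_form_odd_b[OF form]] by simp
qed

text \<open>The last even case uses \<open>N - lucas (2*n + 2)\<close>, the element of
  \<open>\<Lambda> (2*n)\<close> that \<open>N\<close> is a translate of. With
  \<open>lucas (2*n + 1)\<close> it would fail: for \<open>n = 1\<close>, \<open>N = 10\<close>,
  prefixing 10 to the expansion 1010.0001 of 6 puts a 1 at index 5, and
  \<open>phi^5 > 11\<close>.\<close>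

theorem theorem3p3:
  fixes n :: nat
  assumes "n \<ge> 1"
  shows
    "(let A = translate (\<Lambda> (2*n - 1)) (lucas (2*n));
         B = translate (\<Lambda> (2*n - 2)) (lucas (2*n + 1));
         C = translate (\<Lambda> (2*n - 1)) (lucas (2*n + 1))
     in \<Lambda> (2*n + 1) = A \<union> B \<union> C \<and>
        consecutive_intervals A B C \<and>
        A \<inter> B = {} \<and> A \<inter> C = {} \<and> B \<inter> C = {} \<and>
        (\<forall>N\<in>A. fg_word (beta N) =
           fg_word [D1, D0, D0, D0] * inverse (fg_word [D1, D0]) *
           fg_word (beta (N - lucas (2*n))) *
           inverse (fg_word [D0, D1]) * fg_word [D1, D0, D0, D1]) \<and>
        (\<forall>N\<in>B. fg_word (beta N) =
           fg_word [D1, D0, D0] *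
           fg_word (beta (N - lucas (2*n + 1))) *
           inverse (fg_word [D0, D1]) * fg_word [D0, D0, D1, D0, D0, D1]) \<and>
        (\<forall>N\<in>C. fg_word (beta N) =
           fg_word [D1, D0] *
           fg_word (beta (N - lucas (2*n + 1))) *
           inverse (fg_word [D0, D1]) * fg_word [D0, D0, D0, D1])) \<and>
     (let A = translate (\<Lambda> (2*n)) (lucas (2*n + 1));
         B = translate (\<Lambda> (2*n - 1)) (lucas (2*n + 2));
         C = translate (\<Lambda> (2*n)) (lucas (2*n + 2))
     in \<Lambda> (2*n + 2) = A \<union> B \<union> C \<and>
        consecutive_intervals A B C \<and>
        A \<inter> B = {} \<and> A \<inter> C = {} \<and> B \<inter> C = {} \<and>
        (\<forall>N\<in>A. fg_word (beta N) =
           fg_word [D1, D0, D0, D0] * inverse (fg_word [D1, D0]) *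
           fg_word (beta (N - lucas (2*n + 1))) *
           inverse (fg_word [D0, D1]) * fg_word [D0, D0, D0, D1]) \<and>
        (\<forall>N\<in>B. fg_word (beta N) =
           fg_word [D1, D0, D0] *
           fg_word (beta (N - lucas (2*n + 2))) *
           fg_word [D0, D1]) \<and>
        (\<forall>N\<in>C. fg_word (beta N) =
           fg_word [D1, D0] *
           fg_word (beta (N - lucas (2*n + 2))) *
           fg_word [D0, D1]))"
proof -
  \<comment> \<open>This turns the truncated subtractions \<open>2*n - 1\<close> and
    \<open>2*n - 2\<close> into \<open>2*m + 1\<close> and \<open>2*m\<close>.\<close>
  obtain m where n: "n = Suc m" using assms by (cases n) auto
  have idx: "2 * n = 2 * m + 2" "2 * m + 2 - 2 = 2 * m" "2 * m + 2 - 1 = 2 * m + 1"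
    "2 * m + 2 + 1 = 2 * m + 3" "2 * m + 2 + 2 = 2 * m + 4"
    by (simp_all add: n)
  \<comment> \<open>Taking \<open>M\<close> as \<open>N\<close> minus the shift turns the sum into
    \<open>N\<close> and the hypothesis into membership in a translate. \<open>beta_even\<close> is
    used at \<open>m\<close> for the odd case and at \<open>n\<close> for the even ones.\<close>
  note recursions =
    beta_odd(1)[of "N - lucas (2 * m + 2)" m for N, unfolded diff_add_cancel, folded translate_iff]
    beta_odd(2)[of "N - lucas (2 * m + 3)" m for N, unfolded diff_add_cancel, folded translate_iff]
    beta_odd(3)[of "N - lucas (2 * m + 4)" m for N, unfolded diff_add_cancel, folded translate_iff]
    beta_even(3)[of "N - lucas (2 * m + 3)" m for N, unfolded diff_add_cancel, folded translate_iff]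
    beta_even(1)[of "N - lucas (2 * n + 1)" n for N, unfolded diff_add_cancel idx, folded translate_iff]
    beta_even(2)[of "N - lucas (2 * n + 2)" n for N, unfolded diff_add_cancel idx, folded translate_iff]
  show ?thesis
    unfolding Let_def idx
    by (intro conjI ballI)
      ((rule recursions, assumption) | simp only: Lucas_interval_odd_split Lucas_interval_even_split)+
qed

end
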